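(* Let $f(n)=an^{2}+bn+c$ with $a,b,c\in\mathbb{Z}$, $a$ odd and $b$ even. Suppose $b^{2}-4ac=4^{\ell}\Delta$ where $\ell$ is the largest positive integer with $4^{\ell}\mid b^2-4ac$, $\ell\geq 2$, and $\Delta\equiv m\pmod 8$ with $m\in\{2,3,5,6,7\}$. Then $(\nu_{2}(f(n)))_{n\geq 0}$ is bounded and periodic with minimal period length $2^{\ell}$. Moreover, letting $a^{-1}$ denote an integer inverse of $a$ modulo $2^{\ell}$, for $n\in\mathbb{N}$: \[ \nu_{2}(f(n))=\begin{cases} 0,& \text{if } n\equiv a^{-1}\left(1-\tfrac{b}{2}\right)\pmod 2;\\ 2(i-1),& \text{if } n\equiv a^{-1}\left(2^{i-1}-\tfrac{b}{2}\right)\pmod{2^{i}} \text{ with } 2\leq i<\ell;\\ 2(\ell-1),& \text{if } n\equiv a^{-1}\left(2^{\ell-1}-\tfrac{b}{2}\right)\pmod{2^{\ell}} \text{ and } m\in\{2,6\};\\ 2\ell-1,& \text{if } n\equiv a^{-1}\left(2^{\ell-1}-\tfrac{b}{2}\right)\pmod{2^{\ell}} \text{ and } m\in\{3,7\};\\ 2\ell,& \text{if } n\equiv a^{-1}\left(2^{\ell-1}-\tfrac{b}{2}\right)\pmod{2^{\ell}} \text{ and } m=5;\\ 2\ell-1,& \text{if } n\equiv a^{-1}\left(2^{\ell}-\tfrac{b}{2}\right)\pmod{2^{\ell}} \text{ and } m\in\{2,6\};\\ 2(\ell-1),& \text{if } n\equiv a^{-1}\left(2^{\ell}-\tfrac{b}{2}\right)\pmod{2^{\ell}}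 \text{ and } m\in\{3,5,7\}. \end{cases} \]
   Context: $\mathbb{N}=\{0,1,2,\ldots\}$. For an integer $x\neq 0$, $\nu_2(x)$ is the exponent of the highest power of $2$ dividing $x$, and $\nu_2(0)=+\infty$. *)

theory Defs
  imports Complex_Main "HOL-Library.Extended_Nat" "HOL-Number_Theory.Number_Theory"
begin

text \<open>The library sets \<open>multiplicity p 0 = 0\<close>; here the valuation of \<open>0\<close> is infinite.\<close>

definition nu2 :: "int \<Rightarrow> enat" where
  "nu2 x = (if x = 0 then \<infinity> else enat (multiplicity 2 x))"

definition bounded_seq :: "(nat \<Rightarrow> enat) \<Rightarrow> bool" where
  "bounded_seq s \<longleftrightarrow> (\<exists>B::nat. \<forall>n. s n \<le> enat B)"

definition is_period :: "(nat \<Rightarrow> 'a) \<Rightarrow> nat \<Rightarrow> bool" where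
  "is_period s p \<longleftrightarrow> p > 0 \<and> (\<forall>n. s (n + p) = s n)"

definition minimal_period :: "(nat \<Rightarrow> 'a) \<Rightarrow> nat \<Rightarrow> bool" where
  "minimal_period s p \<longleftrightarrow> is_period s p \<and> (\<forall>q. is_period s q \<longrightarrow> p \<le> q)"

end

theory Submission
  imports Defs
begin

text \<open>
  Completing the square, a f(n) = x^2 - 4^(l-1) \<Delta> with x = a n + b/2, and a is odd, so the
  valuation of f(n) is that of x^2 - 4^(l-1) \<Delta>. If x has valuation j < l - 1, the first term
  dominates and the valuation is 2 j. Otherwise x = 2^(l-1) u and one is left with the valuation
  of u^2 - \<Delta>, which depends only on m and on the parity of u since odd squares are 1 modulo 8.
  For every admissible m the two parities give different values, both at least 2 (l - 1), so the
  value at x = 0 is attained exactly when 2^l divides x; hence every period is a multiple of 2^l.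
\<close>

section \<open>Valuations and residue classes modulo powers of two\<close>

lemma nu2_times_odd:
  assumes "odd a"
  shows "nu2 (a * y) = nu2 y"
proof (cases "y = 0")
  case False
  have "multiplicity 2 a = 0" using assms by (simp add: not_dvd_imp_multiplicity_0)
  moreover have "a \<noteq> 0" using assms by auto
  ultimately show ?thesis
    using False by (simp add: nu2_def prime_elem_multiplicity_mult_distrib)
qed (simp add: nu2_def)

lemma nu2_times_power: "nu2 (2 ^ k * y) = enat k + nu2 y"
  by (simp add: nu2_def prime_elem_multiplicity_mult_distrib multiplicity_same_power)

lemma nu2_odd: "odd u \<Longrightarrow> nu2 u = 0"
  by (auto simp: nu2_def zero_enat_def not_dvd_imp_multiplicity_0)

lemma nu2_power_times_odd: "odd u \<Longrightarrow> nu2 (2 ^ k * u) = enat k"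
  by (simp add: nu2_times_power nu2_odd)

text \<open>Case rule for the later arguments: either \<open>2 ^ L\<close> splits off, or the exact
  valuation \<open>j\<close> is below \<open>L\<close>. Zero falls under the first case, so the
  library value \<open>multiplicity 2 0\<close> does not matter.\<close>

lemma power_dvd_or_odd_part:
  fixes x :: int
  obtains (dvd) u where "x = 2 ^ L * u" | (less) j u where "j < L" "odd u" "x = 2 ^ j * u"
proof (cases "2 ^ L dvd x")
  case True
  then show ?thesis using that(1) by auto
next
  case False
  then have "x \<noteq> 0" by auto
  then obtain u where u: "x = 2 ^ multiplicity 2 x * u" "\<not> 2 dvd u"
    using multiplicity_decompose'[of x "2::int"] by auto
  have "multiplicity 2 x < L"
  proof (rule ccontr)
    assume "\<not> multiplicity 2 x < L"
    then have "(2::int) ^ L dvd 2 ^ multiplicity 2 x" by (simp add: le_imp_power_dvd)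
    then show False using False u(1) by (metis dvd_mult2)
  qed
  then show ?thesis using that(2) u by blast
qed

text \<open>The multiples of \<open>2 ^ j\<close> fill two classes modulo \<open>2 ^ Suc j\<close>,
  and the nonzero one holds the odd multiples. Such a congruence thus fixes the valuation at
  \<open>j\<close>.\<close>

lemma cong_half_modulus_iff:
  fixes x :: int
  shows "[x = 2 ^ j] (mod 2 ^ Suc j) \<longleftrightarrow> (\<exists>u. odd u \<and> x = 2 ^ j * u)"
proof
  assume "[x = 2 ^ j] (mod 2 ^ Suc j)"
  then obtain k where "x = 2 ^ j + k * 2 ^ Suc j"
    by (metis cong_iff_lin cong_sym mult.commute)
  then have "x = 2 ^ j * (1 + 2 * k)" by (simp add: algebra_simps)
  then show "\<exists>u. odd u \<and> x = 2 ^ j * u" by force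
next
  assume "\<exists>u. odd u \<and> x = 2 ^ j * u"
  then obtain k where "x = 2 ^ j * (2 * k + 1)" by (auto elim!: oddE)
  then have "x - 2 ^ j = 2 ^ Suc j * k" by (simp add: algebra_simps)
  then show "[x = 2 ^ j] (mod 2 ^ Suc j)" by (simp add: cong_iff_dvd_diff)
qed

text \<open>\<open>a\<close> is a unit modulo each divisor \<open>N\<close> of \<open>M\<close>, so
  multiplying by it loses nothing. Two moduli occur because one inverse modulo \<open>2 ^ l\<close>
  serves all moduli \<open>2 ^ i\<close>.\<close>

lemma cong_inverse_shift_iff:
  fixes a a' x h t :: int
  assumes "[a * a' = 1] (mod M)" and "N dvd M"
  shows "[x = a' * (t - h)] (mod N) \<longleftrightarrow> [a * x + h = t] (mod N)"
proof -
  have inv: "[a * a' = 1] (mod N)" using assms by (rule cong_dvd_modulus)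
  then have "coprime a N" by (metis coprime_iff_invertible_int)
  then have "[x = a' * (t - h)] (mod N) \<longleftrightarrow> [a * x = a * (a' * (t - h))] (mod N)"
    by (simp add: cong_mult_lcancel)
  also have "\<dots> \<longleftrightarrow> [a * x = t - h] (mod N)"
    using cong_mult[OF inv cong_refl[of "t - h"]]
    by (metis cong_sym cong_trans mult.assoc mult_1)
  also have "\<dots> \<longleftrightarrow> [a * x + h = t] (mod N)"
    by (simp add: cong_iff_dvd_diff algebra_simps)
  finally show ?thesis .
qed

section \<open>Valuation of a square minus \<Delta>\<close>

text \<open>The valuation of u^2 - \<Delta> for \<Delta> congruent to m modulo 8; only meaningful for
  m in {2, 3, 5, 6, 7}.\<close>

definition square_diff_val :: "int \<Rightarrow> int \<Rightarrow> nat" where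
  "square_diff_val m u =
    (if odd u then (if m \<in> {2, 6} then 0 else if m \<in> {3, 7} then 1 else 2)
     else (if m \<in> {2, 6} then 1 else 0))"

lemma square_diff_val_le: "square_diff_val m u \<le> 2"
  by (simp add: square_diff_val_def)

text \<open>For each admissible \<open>m\<close> the two parities get different numbers. Right to
  left serves periodicity; left to right recovers the parity from the value, as minimality
  requires.\<close>

lemma square_diff_val_parity_iff:
  assumes "m \<in> {2, 3, 5, 6, 7}"
  shows "square_diff_val m u = square_diff_val m v \<longleftrightarrow> (even u \<longleftrightarrow> even v)"
  using assms by (auto simp: square_diff_val_def)

lemma odd_square_mod_8:
  fixes u :: int
  assumes "odd u"
  shows "\<exists>k. u\<^sup>2 = 8 * k + 1"
proof -
  obtain v where v: "u = 2 * v + 1" using assms by (auto elim: oddE)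
  have "even (v * (v + 1))" by simp
  then obtain k where "v * (v + 1) = 2 * k" by (rule evenE)
  then have "u\<^sup>2 = 8 * k + 1" by (simp add: v power2_eq_square algebra_simps)
  then show ?thesis ..
qed

text \<open>The difference is 1 - m modulo 8 for odd \<open>u\<close> and -m modulo 4 for even
  \<open>u\<close>. These residues are nonzero, so they determine the valuation.\<close>

lemma nu2_square_diff:
  assumes "[\<Delta> = m] (mod 8)" and m: "m \<in> {2, 3, 5, 6, 7}"
  shows "nu2 (u\<^sup>2 - \<Delta>) = enat (square_diff_val m u)"
proof -
  obtain d where d: "\<Delta> = m + 8 * d"
    using assms(1) by (metis cong_iff_lin cong_sym_eq)
  have val: "nu2 (u\<^sup>2 - \<Delta>) = enat r" if "u\<^sup>2 - \<Delta> = 2 ^ r * w" "odd w" for r w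
    using that nu2_power_times_odd by simp
  show ?thesis
  proof (cases "odd u")
    case True
    then obtain k where k: "u\<^sup>2 = 8 * k + 1" using odd_square_mod_8 by blast
    \<comment> \<open>The witnesses are 8 (k - d) + 1 - m divided by the power of two in 1 -
      m.\<close>
    have "nu2 (u\<^sup>2 - \<Delta>) = enat 0" if "m \<in> {2, 6}"
      by (rule val[of 0 "u\<^sup>2 - \<Delta>"]) (use that k d in auto)
    moreover have "nu2 (u\<^sup>2 - \<Delta>) = enat 1" if "m = 3"
      by (rule val[of 1 "4 * k - 4 * d - 1"]) (use that k d in auto)
    moreover have "nu2 (u\<^sup>2 - \<Delta>) = enat 1" if "m = 7"
      by (rule val[of 1 "4 * k - 4 * d - 3"]) (use that k d in auto)
    moreover have "nu2 (u\<^sup>2 - \<Delta>) = enat 2" if "m = 5"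
      by (rule val[of 2 "2 * k - 2 * d - 1"]) (use that k d in auto)
    ultimately show ?thesis using True m by (auto simp: square_diff_val_def)
  next
    case False
    then obtain v where v: "u = 2 * v" by (auto elim: evenE)
    have sq: "u\<^sup>2 = 4 * v\<^sup>2" by (simp add: v power2_eq_square)
    have "nu2 (u\<^sup>2 - \<Delta>) = enat 0" if "m \<in> {3, 5, 7}"
      by (rule val[of 0 "u\<^sup>2 - \<Delta>"]) (use that sq d in auto)
    moreover have "nu2 (u\<^sup>2 - \<Delta>) = enat 1" if "m = 2"
      by (rule val[of 1 "2 * v\<^sup>2 - 4 * d - 1"]) (use that sq d in auto)
    moreover have "nu2 (u\<^sup>2 - \<Delta>) = enat 1" if "m = 6"
      by (rule val[of 1 "2 * v\<^sup>2 - 4 * d - 3"]) (use that sq d in auto)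
    ultimately show ?thesis using False m by (auto simp: square_diff_val_def)
  qed
qed

section \<open>Valuation of a square minus a scaled \<Delta>\<close>

text \<open>Once \<open>4 ^ j\<close> is factored out, the second term keeps a factor 4, leaving an
  odd square minus an even number.\<close>

lemma nu2_square_diff_less:
  assumes "odd u" and "j < L"
  shows "nu2 ((2 ^ j * u)\<^sup>2 - 4 ^ L * \<Delta>) = enat (2 * j)"
proof -
  obtain i where L: "L = j + Suc i" using assms(2) less_imp_Suc_add by auto
  have "(4::int) ^ j = 2 ^ (2 * j)" and "(2 ^ j * u)\<^sup>2 = 2 ^ (2 * j) * u\<^sup>2"
    by (simp add: power_mult) (simp add: power_mult_distrib mult.commute flip: power_mult)
  then have "(2 ^ j * u)\<^sup>2 - 4 ^ L * \<Delta> = 2 ^ (2 * j) * (u\<^sup>2 - 4 * 4 ^ i * \<Delta>)"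
    unfolding L by (simp add: power_add algebra_simps)
  moreover have "odd (u\<^sup>2 - 4 * 4 ^ i * \<Delta>)" using assms(1) by simp
  ultimately show ?thesis by (simp add: nu2_power_times_odd)
qed

lemma nu2_square_diff_dvd:
  assumes "[\<Delta> = m] (mod 8)" and "m \<in> {2, 3, 5, 6, 7}"
  shows "nu2 ((2 ^ L * u)\<^sup>2 - 4 ^ L * \<Delta>) = enat (2 * L + square_diff_val m u)"
proof -
  have "(4::int) ^ L = 2 ^ (2 * L)" and "(2 ^ L * u)\<^sup>2 = 2 ^ (2 * L) * u\<^sup>2"
    by (simp add: power_mult) (simp add: power_mult_distrib mult.commute flip: power_mult)
  then have "(2 ^ L * u)\<^sup>2 - 4 ^ L * \<Delta> = 2 ^ (2 * L) * (u\<^sup>2 - \<Delta>)"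
    by (simp add: algebra_simps)
  then show ?thesis using nu2_square_diff[OF assms] by (simp add: nu2_times_power)
qed

context
  fixes \<Delta> m :: int
  assumes \<Delta>: "[\<Delta> = m] (mod 8)" and m: "m \<in> {2, 3, 5, 6, 7}"
begin

lemma nu2_square_diff_le: "nu2 (x\<^sup>2 - 4 ^ L * \<Delta>) \<le> enat (2 * L + 2)"
proof (cases x rule: power_dvd_or_odd_part[of _ L])
  case (dvd u)
  then show ?thesis
    using nu2_square_diff_dvd[OF \<Delta> m] square_diff_val_le by simp
next
  case (less j u)
  then show ?thesis using nu2_square_diff_less by simp
qed

text \<open>The shift is an even multiple of \<open>2 ^ L\<close>, hence of \<open>2 ^ j\<close> for
  \<open>j < L\<close>, so in both cases the cofactor \<open>u\<close> keeps its parity.\<close>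

lemma nu2_square_diff_periodic:
  "nu2 ((x + 2 ^ Suc L * t)\<^sup>2 - 4 ^ L * \<Delta>) = nu2 (x\<^sup>2 - 4 ^ L * \<Delta>)"
proof (cases x rule: power_dvd_or_odd_part[of _ L])
  case (dvd u)
  then have "x + 2 ^ Suc L * t = 2 ^ L * (u + 2 * t)" by (simp add: algebra_simps)
  moreover have "square_diff_val m (u + 2 * t) = square_diff_val m u"
    using m by (subst square_diff_val_parity_iff) auto
  ultimately show ?thesis using nu2_square_diff_dvd[OF \<Delta> m] dvd by simp
next
  case (less j u)
  then obtain i where L: "L = j + Suc i" using less_imp_Suc_add by auto
  have "x + 2 ^ Suc L * t = 2 ^ j * (u + 2 * (2 ^ Suc i * t))"
    unfolding L less(3) by (simp add: power_add algebra_simps)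
  moreover have "odd (u + 2 * (2 ^ Suc i * t))" using less by simp
  ultimately show ?thesis using less nu2_square_diff_less[of _ j L \<Delta>]
    by (metis (no_types))
qed

text \<open>The value tested is the one at \<open>x = 0\<close>. Valuations \<open>j < L\<close>
  give \<open>2 * j\<close>, which is too small, and odd multiples of \<open>2 ^ L\<close> give the
  value of the other parity.\<close>

lemma nu2_square_diff_eq_zero_iff:
  "nu2 (x\<^sup>2 - 4 ^ L * \<Delta>) = enat (2 * L + square_diff_val m 0) \<longleftrightarrow> 2 ^ Suc L dvd x"
proof (cases x rule: power_dvd_or_odd_part[of _ L])
  case (dvd u)
  then have "nu2 (x\<^sup>2 - 4 ^ L * \<Delta>) = enat (2 * L + square_diff_val m 0) \<longleftrightarrow> even u"
    using nu2_square_diff_dvd[OF \<Delta> m] square_diff_val_parity_iff[OF m, of u 0] by simp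
  then show ?thesis using dvd by (simp add: mult.commute)
next
  case (less j u)
  have "\<not> 2 ^ Suc L dvd x"
  proof
    assume "2 ^ Suc L dvd x"
    moreover have "(2::int) ^ Suc j dvd 2 ^ Suc L" using less by (intro le_imp_power_dvd) simp
    ultimately have "2 ^ Suc j dvd x" by (rule dvd_trans[rotated])
    then show False using less by (simp add: mult.commute)
  qed
  then show ?thesis using less nu2_square_diff_less by simp
qed

end

theorem theorem2:
  fixes a b c \<Delta> m :: int and l :: nat and f :: "nat \<Rightarrow> int"
  assumes f: "\<And>n. f n = a * (int n)\<^sup>2 + b * int n + c"
    and a: "odd a" and b: "even b"
    and disc: "b\<^sup>2 - 4 * a * c = 4 ^ l * \<Delta>"
    and l_max: "\<And>k::nat. k > 0 \<Longrightarrow> 4 ^ k dvd b\<^sup>2 - 4 * a * c \<Longrightarrow> k \<le> l"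
    and l: "l \<ge> 2"
    and \<Delta>: "[\<Delta> = m] (mod 8)" and m: "m \<in> {2, 3, 5, 6, 7}"
  shows "bounded_seq (\<lambda>n. nu2 (f n)) \<and>
    minimal_period (\<lambda>n. nu2 (f n)) (2 ^ l) \<and>
    (\<forall>a' :: int. [a * a' = 1] (mod 2 ^ l) \<longrightarrow> (\<forall>n::nat.
      ([int n = a' * (1 - b div 2)] (mod 2) \<longrightarrow> nu2 (f n) = 0) \<and>
      (\<forall>i::nat. 2 \<le> i \<and> i < l \<and> [int n = a' * (2 ^ (i - 1) - b div 2)] (mod 2 ^ i)
         \<longrightarrow> nu2 (f n) = enat (2 * (i - 1))) \<and>
      ([int n = a' * (2 ^ (l - 1) - b div 2)] (mod 2 ^ l) \<and> m \<in> {2, 6}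
         \<longrightarrow> nu2 (f n) = enat (2 * (l - 1))) \<and>
      ([int n = a' * (2 ^ (l - 1) - b div 2)] (mod 2 ^ l) \<and> m \<in> {3, 7}
         \<longrightarrow> nu2 (f n) = enat (2 * l - 1)) \<and>
      ([int n = a' * (2 ^ (l - 1) - b div 2)] (mod 2 ^ l) \<and> m = 5
         \<longrightarrow> nu2 (f n) = enat (2 * l)) \<and>
      ([int n = a' * (2 ^ l - b div 2)] (mod 2 ^ l) \<and> m \<in> {2, 6}
         \<longrightarrow> nu2 (f n) = enat (2 * l - 1)) \<and>
      ([int n = a' * (2 ^ l - b div 2)] (mod 2 ^ l) \<and> m \<in> {3, 5, 7}
         \<longrightarrow> nu2 (f n) = enat (2 * (l - 1))) \<and>
      ([int n = a' * (1 - b div 2)] (mod 2) \<or>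
       (\<exists>i::nat. 2 \<le> i \<and> i < l \<and> [int n = a' * (2 ^ (i - 1) - b div 2)] (mod 2 ^ i)) \<or>
       [int n = a' * (2 ^ (l - 1) - b div 2)] (mod 2 ^ l) \<or>
       [int n = a' * (2 ^ l - b div 2)] (mod 2 ^ l))))"
proof -
  define h where "h = b div 2"
  \<comment> \<open>As \<open>b\<close> is even, a factor 4 cancels from the discriminant, so the
    working exponent is one below \<open>l\<close>.\<close>
  define L where "L = l - 1"
  define X where "X n = a * int n + h" for n :: nat
  have bh: "b = 2 * h" using b by (simp add: h_def)
  have lL: "l = Suc L" and L: "L \<ge> 1" using l by (simp_all add: L_def)
  have "4 * (h\<^sup>2 - a * c) = 4 * (4 ^ L * \<Delta>)"
    using disc by (simp add: bh lL power_mult_distrib)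
  then have hc: "h\<^sup>2 - a * c = 4 ^ L * \<Delta>" by simp
  have "a * f n = (X n)\<^sup>2 - 4 ^ L * \<Delta>" for n
    unfolding f X_def hc[symmetric] bh by (simp add: power2_eq_square algebra_simps)
  then have nu: "nu2 (f n) = nu2 ((X n)\<^sup>2 - 4 ^ L * \<Delta>)" for n
    using nu2_times_odd[OF a] by metis
  have shift: "[int n = a' * (t - b div 2)] (mod 2 ^ i) \<longleftrightarrow> [X n = t] (mod 2 ^ i)"
    if "[a * a' = 1] (mod 2 ^ l)" "i \<le> l" for a' n t i
    unfolding X_def h_def[symmetric]
    using that by (intro cong_inverse_shift_iff) (auto intro: le_imp_power_dvd)

  have "bounded_seq (\<lambda>n. nu2 (f n))"
    unfolding bounded_seq_def nu using nu2_square_diff_le[OF \<Delta> m] by blast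
  moreover have "minimal_period (\<lambda>n. nu2 (f n)) (2 ^ l)"
    unfolding minimal_period_def
  proof (intro conjI allI impI)
    have "X (n + 2 ^ l) = X n + 2 ^ Suc L * a" for n by (simp add: X_def lL algebra_simps)
    then show "is_period (\<lambda>n. nu2 (f n)) (2 ^ l)"
      unfolding is_period_def nu using nu2_square_diff_periodic[OF \<Delta> m] by simp
  next
    fix q assume q: "is_period (\<lambda>n. nu2 (f n)) q"
    \<comment> \<open>Invertibility of \<open>a\<close> gives a zero of \<open>X\<close> modulo
      \<open>2 ^ l\<close>; reducing it yields a natural number \<open>n\<close>.\<close>
    have cop: "coprime a (2 ^ l)" using a by (simp add: coprime_commute)
    then obtain y where y: "[a * y = - h] (mod 2 ^ l)"
      using cong_solve_coprime_int[of a "2 ^ l"] cong_scalar_right[of _ 1 "2 ^ l" "- h"]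
      by (metis mult.assoc mult_1)
    define n where "n = nat (y mod 2 ^ l)"
    have "[int n = y] (mod 2 ^ l)" by (simp add: n_def)
    then have "[a * int n = - h] (mod 2 ^ l)" using y cong_scalar_left cong_trans by blast
    then have "2 ^ l dvd X n" by (simp add: X_def cong_iff_dvd_diff)
    \<comment> \<open>The period carries the value at \<open>n\<close> to \<open>n + q\<close>, and
      this value forces divisibility. The difference of the two terms is
      \<open>a * int q\<close>.\<close>
    moreover from this have "2 ^ l dvd X (n + q)"
      using q nu2_square_diff_eq_zero_iff[OF \<Delta> m, of _ L]
      unfolding is_period_def nu lL by metis
    ultimately have "2 ^ l dvd X (n + q) - X n" by (rule dvd_diff[rotated])
    then have "2 ^ l dvd a * int q" by (simp add: X_def algebra_simps)
    then have "2 ^ l dvd int q" using cop by (simp add: coprime_dvd_mult_right_iff coprime_commute)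
    then have "2 ^ l dvd q" by (metis of_nat_dvd_iff of_nat_numeral of_nat_power)
    then show "2 ^ l \<le> q" using q by (simp add: is_period_def dvd_imp_le)
  qed
  \<comment> \<open>The clauses that depend on \<open>m\<close> are merged into two, one for odd and
    one for even cofactors of \<open>2 ^ L\<close>; the listed values are read off at the
    end.\<close>
  moreover have "([int n = a' * (1 - b div 2)] (mod 2) \<longrightarrow> nu2 (f n) = 0) \<and>
      (\<forall>i::nat. 2 \<le> i \<and> i < l \<and> [int n = a' * (2 ^ (i - 1) - b div 2)] (mod 2 ^ i)
         \<longrightarrow> nu2 (f n) = enat (2 * (i - 1))) \<and>
      ([int n = a' * (2 ^ (l - 1) - b div 2)] (mod 2 ^ l) \<longrightarrow>
         nu2 (f n) = enat (2 * L + square_diff_val m 1)) \<and>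
      ([int n = a' * (2 ^ l - b div 2)] (mod 2 ^ l) \<longrightarrow>
         nu2 (f n) = enat (2 * L + square_diff_val m 0)) \<and>
      ([int n = a' * (1 - b div 2)] (mod 2) \<or>
       (\<exists>i::nat. 2 \<le> i \<and> i < l \<and> [int n = a' * (2 ^ (i - 1) - b div 2)] (mod 2 ^ i)) \<or>
       [int n = a' * (2 ^ (l - 1) - b div 2)] (mod 2 ^ l) \<or>
       [int n = a' * (2 ^ l - b div 2)] (mod 2 ^ l))"
    (is "?first \<and> ?middle \<and> ?top \<and> ?zero \<and> ?cover")
    if inv: "[a * a' = 1] (mod 2 ^ l)" for a' n
  proof -
    have first_iff: "[int n = a' * (1 - b div 2)] (mod 2) \<longleftrightarrow> (\<exists>u. odd u \<and> X n = 2 ^ 0 * u)"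
      using shift[OF inv, of 1 n 1] lL cong_half_modulus_iff[of "X n" 0] by simp
    have middle_iff: "[int n = a' * (2 ^ (i - 1) - b div 2)] (mod 2 ^ i) \<longleftrightarrow>
        (\<exists>u. odd u \<and> X n = 2 ^ (i - 1) * u)" if "1 \<le> i" "i \<le> l" for i
      using shift[OF inv, of i n "2 ^ (i - 1)"] that cong_half_modulus_iff[of "X n" "i - 1"] by simp
    have zero_iff: "[int n = a' * (2 ^ l - b div 2)] (mod 2 ^ l) \<longleftrightarrow> 2 ^ Suc L dvd X n"
      using shift[OF inv, of l n "2 ^ l"] lL
      by (simp add: cong_iff_dvd_diff dvd_diff_left_iff del: power_Suc)
    have ?first
      unfolding first_iff nu using nu2_square_diff_less[of _ 0 L] L by (auto simp: enat_0)
    moreover have ?middle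
    proof (intro allI impI)
      fix i :: nat
      assume i: "2 \<le> i \<and> i < l \<and> [int n = a' * (2 ^ (i - 1) - b div 2)] (mod 2 ^ i)"
      then obtain u where "odd u" "X n = 2 ^ (i - 1) * u" using middle_iff[of i] by auto
      moreover have "i - 1 < L" using i lL by linarith
      ultimately show "nu2 (f n) = enat (2 * (i - 1))" unfolding nu
        by (simp add: nu2_square_diff_less)
    qed
    moreover have ?top
    proof
      assume "[int n = a' * (2 ^ (l - 1) - b div 2)] (mod 2 ^ l)"
      then obtain u where "odd u" "X n = 2 ^ L * u" using middle_iff[of l] lL by auto
      moreover from this have "square_diff_val m u = square_diff_val m 1"
        using square_diff_val_parity_iff[OF m] by simp
      ultimately show "nu2 (f n) = enat (2 * L + square_diff_val m 1)"
        using nu2_square_diff_dvd[OF \<Delta> m] unfolding nu by simp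
    qed
    moreover have ?zero
      unfolding zero_iff nu using nu2_square_diff_eq_zero_iff[OF \<Delta> m] by blast
    \<comment> \<open>The case rule mirrors the classes: valuation \<open>j < L\<close> gives the
      class with \<open>i = j + 1\<close> (the first clause is \<open>j = 0\<close>), and the parity
      of the cofactor of \<open>2 ^ L\<close> selects one of the last two.\<close>
    moreover have ?cover
    proof (cases "X n" rule: power_dvd_or_odd_part[of _ L])
      case (dvd u)
      then show ?thesis using middle_iff[of l] zero_iff lL by (cases "even u") auto
    next
      case (less j u)
      show ?thesis
      proof (cases j)
        case 0
        then show ?thesis using first_iff less by blast
      next
        case (Suc k)
        then show ?thesis using middle_iff[of "Suc j"] less lL
          by (intro disjI2 disjI1 exI[of _ "Suc j"]) auto
      qed
    qed
    ultimately show ?thesis by blast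
  qed
  moreover have "m \<in> {2, 6} \<Longrightarrow> 2 * L + square_diff_val m 1 = 2 * (l - 1)"
    "m \<in> {3, 7} \<Longrightarrow> 2 * L + square_diff_val m 1 = 2 * l - 1"
    "m = 5 \<Longrightarrow> 2 * L + square_diff_val m 1 = 2 * l"
    "m \<in> {2, 6} \<Longrightarrow> 2 * L + square_diff_val m 0 = 2 * l - 1"
    "m \<in> {3, 5, 7} \<Longrightarrow> 2 * L + square_diff_val m 0 = 2 * (l - 1)"
    by (auto simp: square_diff_val_def lL)
  ultimately show ?thesis by (intro conjI allI impI; metis)
qed

end
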